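(* For every resource $\alpha$ there is a cirquent $C$, in fact a literal cirquent, such that $C^\clubsuit=\alpha$.
   Context: Resources: a port is an atom $P$ (output) or $-P$ (input). An interface is a finite sequence $I=\langle X_1,\dots,X_n\rangle$ of ports; a situation for it is a bit string $\mathbf s$ of length $n$. $\mathbf s\le_I\mathbf s'$ iff for each $i$, $\mathbf s(i)\le\mathbf s'(i)$ if $X_i$ is an output and $\mathbf s'(i)\le\mathbf s(i)$ if $X_i$ is an input. A resource is a pair $\alpha=(\mathrm{Int}^\alpha,\mathrm{Tfn}^\alpha)$ of an interface and a function from its situations to $\{0,1\}$ that is monotone: $\mathbf s\le\mathbf s'$ implies $\mathrm{Tfn}^\alpha(\mathbf s)\le\mathrm{Tfn}^\alpha(\mathbf s')$. Formulas: built from atoms with $\neg,\wedge,\vee$, $\neg$ only on atoms; a literal is $P$ or $\neg P$. A $k$-ary cirquent is a pair consisting of a structure (a finite sequence, repetitions allowed, of subsets of $\{1,\dots,k\}$, called groups) and a pool $\langle F_1,\dots,F_k\rangle$ of formulas (oformulas); group $\Gamma$ contains $F_i$ for $i\in\Gamma$. A literal cirquent is one whose pool consists only of literals. A situation for a cirquent assigns truth values to all occurrences of atoms in its oformulas (a bit string, in order of appearance); an oformula is true in it by the classical recursive clauses applied to occurrences ($\neg P$ true iff that occurrence of $P$ is false); a group is true iff at least one of its oformulas is; the cirquent is true iff all its groups are. With $\mathrm{Port}(P)=P$, $\mathrm{Port}(\neg P)=-P$, the resource $C^\clubsuit$ has interface $\langle\mathrm{Port}(L_1),\dots,\mathrm{Port}(L_n)\rangle$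 where $L_1,\dots,L_n$ are the literal occurrences of $C$ in order of appearance, and is true in $\mathbf s$ iff $C$ is true in $\mathbf s$. *)

theory Defs
  imports "HOL-Library.FuncSet"
begin

datatype 'a port = Output 'a | Input 'a

type_synonym 'a interface = "'a port list"

type_synonym situation = "bool list"

definition situations :: "'a interface \<Rightarrow> situation set" where
  "situations I = {s. length s = length I}"

definition situation_le :: "'a interface \<Rightarrow> situation \<Rightarrow> situation \<Rightarrow> bool" where
  "situation_le I s s' \<longleftrightarrow>
     (\<forall>i < length I. case I ! i of
        Output P \<Rightarrow> s ! i \<le> s' ! i
      | Input P \<Rightarrow> s' ! i \<le> s ! i)"

text \<open>
  The truth function of a resource has only the situations of its interface as its domain. It is
  represented by a function that is \<^const>\<open>undefined\<close> elsewhere, so that equality of resources is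
  equality of pairs.
\<close>

type_synonym 'a resource = "'a interface \<times> (situation \<Rightarrow> bool)"

definition is_resource :: "'a resource \<Rightarrow> bool" where
  "is_resource \<alpha> \<longleftrightarrow>
     (case \<alpha> of (I, T) \<Rightarrow>
        T \<in> situations I \<rightarrow>\<^sub>E UNIV \<and>
        (\<forall>s \<in> situations I. \<forall>s' \<in> situations I. situation_le I s s' \<longrightarrow> T s \<le> T s'))"

datatype 'a literal = Pos 'a | Neg 'a

datatype 'a formula =
    Lit "'a literal"
  | Conj "'a formula" "'a formula"
  | Disj "'a formula" "'a formula"

fun literals :: "'a formula \<Rightarrow> 'a literal list" where
  "literals (Lit L) = [L]"
| "literals (Conj F G) = literals F @ literals G"
| "literals (Disj F G) = literals F @ literals G"

text \<open>
  Every literal occurrence contains exactly one atom occurrence, so a situation for a formula has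
  one bit for each entry of \<^const>\<open>literals\<close>. A bit is the truth value of the atom occurrence, not
  of the literal occurrence.
\<close>

fun formula_true :: "'a formula \<Rightarrow> situation \<Rightarrow> bool" where
  "formula_true (Lit (Pos P)) s \<longleftrightarrow> s ! 0"
| "formula_true (Lit (Neg P)) s \<longleftrightarrow> \<not> s ! 0"
| "formula_true (Conj F G) s \<longleftrightarrow>
     formula_true F (take (length (literals F)) s) \<and>
     formula_true G (drop (length (literals F)) s)"
| "formula_true (Disj F G) s \<longleftrightarrow>
     formula_true F (take (length (literals F)) s) \<or>
     formula_true G (drop (length (literals F)) s)"

text \<open>A cirquent consists of a structure and a pool; oformulas are numbered from 1.\<close>

type_synonym 'a cirquent = "nat set list \<times> 'a formula list"

definition is_cirquent :: "'a cirquent \<Rightarrow> bool" where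
  "is_cirquent C \<longleftrightarrow> (\<forall>\<Gamma> \<in> set (fst C). \<Gamma> \<subseteq> {1..length (snd C)})"

definition literal_cirquent :: "'a cirquent \<Rightarrow> bool" where
  "literal_cirquent C \<longleftrightarrow> is_cirquent C \<and> (\<forall>F \<in> set (snd C). \<exists>L. F = Lit L)"

definition cirquent_literals :: "'a cirquent \<Rightarrow> 'a literal list" where
  "cirquent_literals C = concat (map literals (snd C))"

text \<open>The block of a situation that belongs to the occurrences of atoms in oformula \<open>i\<close>.\<close>

definition oformula_situation :: "'a cirquent \<Rightarrow> nat \<Rightarrow> situation \<Rightarrow> situation" where
  "oformula_situation C i s =
     take (length (literals (snd C ! (i - 1))))
       (drop (length (concat (map literals (take (i - 1) (snd C))))) s)"

definition oformula_true :: "'a cirquent \<Rightarrow> nat \<Rightarrow> situation \<Rightarrow> bool" where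
  "oformula_true C i s \<longleftrightarrow> formula_true (snd C ! (i - 1)) (oformula_situation C i s)"

definition group_true :: "'a cirquent \<Rightarrow> nat set \<Rightarrow> situation \<Rightarrow> bool" where
  "group_true C \<Gamma> s \<longleftrightarrow> (\<exists>i \<in> \<Gamma>. oformula_true C i s)"

definition cirquent_true :: "'a cirquent \<Rightarrow> situation \<Rightarrow> bool" where
  "cirquent_true C s \<longleftrightarrow> (\<forall>\<Gamma> \<in> set (fst C). group_true C \<Gamma> s)"

fun literal_port :: "'a literal \<Rightarrow> 'a port" where
  "literal_port (Pos P) = Output P"
| "literal_port (Neg P) = Input P"

definition cirquent_resource :: "'a cirquent \<Rightarrow> 'a resource"  (\<open>_\<^sup>\<clubsuit>\<close> [1000] 999) where
  "C\<^sup>\<clubsuit> =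
     (let I = map literal_port (cirquent_literals C)
      in (I, \<lambda>s \<in> situations I. cirquent_true C s))"

lemma formula_true_mono:
  assumes "length s = length (literals F)" "length s' = length (literals F)"
    and "situation_le (map literal_port (literals F)) s s'"
    and "formula_true F s"
  shows "formula_true F s'"
proof -
  have app: "situation_le (map literal_port (xs @ ys)) s s' \<Longrightarrow>
      length s = length xs + length ys \<Longrightarrow> length s' = length xs + length ys \<Longrightarrow>
      situation_le (map literal_port xs) (take (length xs) s) (take (length xs) s') \<and>
      situation_le (map literal_port ys) (drop (length xs) s) (drop (length xs) s')"
    for xs ys :: "'a literal list" and s s'
    unfolding situation_le_def
    apply (intro conjI allI impI)
    subgoal for i
      by (drule spec[of _ i]) (simp add: nth_append split: port.splits)
    subgoal for i
      by (drule spec[of _ "length xs + i"]) (simp add: nth_append split: port.splits)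
    done
  show ?thesis using assms
  proof (induction F s arbitrary: s' rule: formula_true.induct)
    case (3 F G s)
    then show ?case using app[of "literals F" "literals G" s s'] by simp
  next
    case (4 F G s)
    then show ?case using app[of "literals F" "literals G" s s'] by auto
  qed (auto simp: situation_le_def)
qed

lemma is_resource_cirquent_resource:
  assumes "is_cirquent C"
  shows "is_resource (C\<^sup>\<clubsuit>)"
proof -
  have step: "oformula_true C i s'"
    if i: "i \<in> {1..length (snd C)}" and s: "length s = length (cirquent_literals C)"
      and s': "length s' = length (cirquent_literals C)"
      and le: "situation_le (map literal_port (cirquent_literals C)) s s'"
      and tr: "oformula_true C i s" for i s s'
  proof -
    define F where "F = snd C ! (i - 1)"
    define A where "A = concat (map literals (take (i - 1) (snd C)))"
    define B where "B = concat (map literals (drop i (snd C)))"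
    have "i - 1 < length (snd C)" "Suc (i - 1) = i"
      using i by auto
    with id_take_nth_drop[of "i - 1" "snd C"]
    have "snd C = take (i - 1) (snd C) @ F # drop i (snd C)"
      unfolding F_def by metis
    from arg_cong[OF this, of "\<lambda>xs. concat (map literals xs)"]
    have C: "cirquent_literals C = A @ literals F @ B"
      unfolding cirquent_literals_def A_def B_def by simp
    have os: "oformula_situation C i t = take (length (literals F)) (drop (length A) t)" for t
      by (simp add: oformula_situation_def F_def A_def)
    have "situation_le (map literal_port (literals F))
        (oformula_situation C i s) (oformula_situation C i s')"
      unfolding situation_le_def
    proof (intro allI impI)
      fix j assume "j < length (map literal_port (literals F))"
      with le[unfolded situation_le_def, rule_format, of "length A + j"] s s'
      show "case map literal_port (literals F) ! j of
          Output P \<Rightarrow> oformula_situation C i s ! j \<le> oformula_situation C i s' ! j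
        | Input P \<Rightarrow> oformula_situation C i s' ! j \<le> oformula_situation C i s ! j"
        by (simp add: C os nth_append split: port.splits)
    qed
    moreover have "length (oformula_situation C i s) = length (literals F)"
      "length (oformula_situation C i s') = length (literals F)"
      using s s' by (simp_all add: C os)
    ultimately show ?thesis
      using tr formula_true_mono unfolding oformula_true_def F_def[symmetric] by blast
  qed
  have "cirquent_true C s'"
    if "length s = length (cirquent_literals C)" "length s' = length (cirquent_literals C)"
      "situation_le (map literal_port (cirquent_literals C)) s s'" "cirquent_true C s" for s s'
    unfolding cirquent_true_def group_true_def
  proof
    fix \<Gamma> assume \<Gamma>: "\<Gamma> \<in> set (fst C)"
    with that(4) obtain i where "i \<in> \<Gamma>" "oformula_true C i s"
      unfolding cirquent_true_def group_true_def by blast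
    moreover have "i \<in> {1..length (snd C)}"
      using assms \<Gamma> \<open>i \<in> \<Gamma>\<close> unfolding is_cirquent_def by blast
    ultimately show "\<exists>i \<in> \<Gamma>. oformula_true C i s'"
      using step that(1-3) by blast
  qed
  then show ?thesis
    by (simp add: is_resource_def cirquent_resource_def Let_def situations_def)
qed

end

theory Submission
  imports Defs
begin

text \<open>
  The cirquent is the conjunctive normal form of the truth function. Each situation \<open>t\<close> in which
  the resource is false contributes the group of all ports whose literal is false in \<open>t\<close>. That
  group is false in \<open>s\<close> exactly if \<open>s \<le> t\<close>, so by monotonicity some group is false in \<open>s\<close> exactly
  if the resource is.
\<close>

fun port_literal :: "'a port \<Rightarrow> 'a literal" where
  "port_literal (Output P) = Pos P"
| "port_literal (Input P) = Neg P"

text \<open>The truth value of \<open>port_literal X\<close> when its atom has the bit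
  \<open>b\<close>.\<close>

fun port_true :: "'a port \<Rightarrow> bool \<Rightarrow> bool" where
  "port_true (Output P) b \<longleftrightarrow> b"
| "port_true (Input P) b \<longleftrightarrow> \<not> b"

lemma literal_port_port_literal [simp]: "literal_port (port_literal X) = X"
  by (cases X) simp_all

text \<open>Negation reverses the order of bits, so in terms of literals the input case reads like
  the output case: going up in the order preserves every true literal.\<close>

lemma situation_le_iff_port_true:
  "situation_le I s t \<longleftrightarrow> (\<forall>i < length I. port_true (I ! i) (s ! i) \<longrightarrow> port_true (I ! i) (t ! i))"
proof -
  have "(case X of Output P \<Rightarrow> a \<le> b | Input P \<Rightarrow> b \<le> a) \<longleftrightarrow> (port_true X a \<longrightarrow> port_true X b)"
    for X :: "'a port" and a b
    by (cases X) auto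
  then show ?thesis
    by (simp add: situation_le_def)
qed

definition port_pool :: "'a interface \<Rightarrow> 'a formula list" where
  "port_pool I = map (Lit \<circ> port_literal) I"

lemma length_port_pool [simp]: "length (port_pool I) = length I"
  by (simp add: port_pool_def)

lemma concat_literals_port_pool: "concat (map literals (port_pool I)) = map port_literal I"
  by (induction I) (simp_all add: port_pool_def)

text \<open>Every oformula is a single literal, so the block of the oformula at list position
  \<open>i\<close> is just bit \<open>i\<close>. Its number is \<open>Suc i\<close> because
  oformulas are numbered from 1.\<close>

lemma oformula_true_port_pool:
  assumes "i < length I" "length s = length I"
  shows "oformula_true (S, port_pool I) (Suc i) s \<longleftrightarrow> port_true (I ! i) (s ! i)"
proof -
  have "take i (port_pool I) = port_pool (take i I)"
    by (simp add: port_pool_def take_map)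
  then have "length (concat (map literals (take i (port_pool I)))) = i"
    using assms by (simp add: concat_literals_port_pool)
  moreover have "port_pool I ! i = Lit (port_literal (I ! i))"
    using assms by (simp add: port_pool_def)
  ultimately show ?thesis
    using assms by (cases "I ! i") (simp_all add: oformula_true_def oformula_situation_def)
qed

definition falsity_group :: "'a interface \<Rightarrow> situation \<Rightarrow> nat set" where
  "falsity_group I t = Suc ` {i. i < length I \<and> \<not> port_true (I ! i) (t ! i)}"

lemma group_true_falsity_group:
  assumes "length s = length I"
  shows "group_true (S, port_pool I) (falsity_group I t) s \<longleftrightarrow> \<not> situation_le I s t"
  using assms
  by (auto simp: group_true_def falsity_group_def situation_le_iff_port_true oformula_true_port_pool)

theorem theorem8p8:
  fixes \<alpha> :: "'a resource"
  assumes "is_resource \<alpha>"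
  shows "\<exists>C :: 'a cirquent. literal_cirquent C \<and> C\<^sup>\<clubsuit> = \<alpha>"
proof -
  obtain I T where \<alpha>: "\<alpha> = (I, T)"
    by (cases \<alpha>)
  have ext: "T \<in> extensional (situations I)"
    and mono: "\<And>s t. s \<in> situations I \<Longrightarrow> t \<in> situations I \<Longrightarrow> situation_le I s t \<Longrightarrow> T s \<Longrightarrow> T t"
    using assms by (auto simp: \<alpha> is_resource_def PiE_def)
  \<comment> \<open>A structure is a finite list of groups, so the false situations have to be
    enumerated.\<close>
  have "finite {t \<in> situations I. \<not> T t}"
    using finite_lists_length_eq[of "UNIV :: bool set" "length I"] by (simp add: situations_def)
  then obtain ts where ts: "set ts = {t \<in> situations I. \<not> T t}"
    using finite_list by blast
  define C where "C = (map (falsity_group I) ts, port_pool I)"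
  have "literal_cirquent C"
    by (auto simp: literal_cirquent_def is_cirquent_def C_def falsity_group_def port_pool_def)
  moreover have "cirquent_true C s \<longleftrightarrow> T s" if s: "s \<in> situations I" for s
  proof -
    have "cirquent_true C s \<longleftrightarrow> (\<forall>t \<in> situations I. \<not> T t \<longrightarrow> \<not> situation_le I s t)"
      using s by (auto simp: cirquent_true_def C_def ts group_true_falsity_group situations_def)
    \<comment> \<open>If \<open>T s\<close> fails, \<open>t = s\<close> violates the left side by
      reflexivity; the converse is monotonicity.\<close>
    also have "\<dots> \<longleftrightarrow> T s"
      using s mono[OF s] by (auto simp: situation_le_iff_port_true)
    finally show ?thesis .
  qed
  moreover have "map literal_port (cirquent_literals C) = I"
    by (simp add: cirquent_literals_def C_def concat_literals_port_pool comp_def)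
  \<comment> \<open>Off the situations of \<open>I\<close>, both truth functions are
    \<open>undefined\<close>, by \<open>ext\<close> and by the restriction in
    \<open>cirquent_resource\<close>.\<close>
  ultimately have "literal_cirquent C \<and> C\<^sup>\<clubsuit> = \<alpha>"
    using ext by (auto simp: cirquent_resource_def \<alpha> extensional_def restrict_def)
  then show ?thesis ..
qed

end
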